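(* Let $(P,\mu,\eta,c)$ be an H-group satisfying $\eta\circ\mu\simeq\mu\circ(\eta\times\eta)\circ T$, where $T:P\times P\to P\times P$, $T(x,y)=(y,x)$. Then there is an isomorphism of groups $$HInn(P)\;\cong\;P/Z(P).$$
   Context: An H-group $(P,\mu,\eta,c)$ is a pointed space $(P,p_0)$ with continuous pointed maps $\mu:P\times P\to P$, $\eta:P\to P$ and the constant map $c:P\to P$ at $p_0$ such that, via pointed homotopies, $\mu(1_P,c)\simeq\mu(c,1_P)\simeq 1_P$, $\mu(\eta,1_P)\simeq\mu(1_P,\eta)\simeq c$ and $\mu(\mu\times 1_P)\simeq\mu(1_P\times\mu)$. Write $g.h=\mu(g,h)$ and $g^{-1}=\eta(g)$. For $A\subseteq P$ and $g\in P$, write $g\,\widetilde{\in}\,A$ if there is a path in $P$ from $g$ to a point of $A$. A sub-H-group of $P$ is a pointed subspace $P'\ni p_0$ which is itself an H-group such that the inclusion is compatible, up to homotopy, with multiplications and inverses. The left coset of a sub-H-group $P'$ is $gP'=\{g'\in P\mid g^{-1}.g'\,\widetilde{\in}\,P'\}$. $P'$ is normal if $g.g'.g^{-1}\,\widetilde{\in}\,P'$ for all $g\in P$, $g'\in P'$; then $P/P'=\{gP'\mid g\in P\}$ is a group under $(g_1P').(g_2P')=(g_1.g_2)P'$. The center of $P$ is $Z(P)=\{g\in P\mid \mu(g,-)\simeq\mu(-,g)\}$, where $\mu(g,-),\mu(-,g):P\to P$; it is a normal sub-H-group of $P$. For $a\in P$ let $\varphi_a:P\to P$, $\varphi_a(g)=a.(g.a^{-1})$.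 $HInn(P)=\{[\varphi_a]\mid a\in P\}$ is the set of homotopy classes of the maps $\varphi_a$; under the stated hypothesis it is a group with $[\varphi_a][\varphi_b]=[\varphi_{a.b}]$ and $[\varphi_a]^{-1}=[\varphi_{a^{-1}}]$. The homotopies between the maps $\varphi_a$, and between $\mu(g,-)$ and $\mu(-,g)$, are free (not base-point preserving). *)

theory Defs
  imports "HOL-Analysis.Homotopy" "HOL-Algebra.Group"
begin

text \<open>The underlying pointed space is a topology \<open>P\<close> with base point \<open>p0\<close>; the constant map of the
  H-group structure is determined by \<open>p0\<close>. Homotopies of the H-group axioms are pointed.\<close>

locale H_group =
  fixes P :: "'a topology" and p0 :: 'a and \<mu> :: "'a \<times> 'a \<Rightarrow> 'a" and \<eta> :: "'a \<Rightarrow> 'a"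
  assumes base_point: "p0 \<in> topspace P"
    and continuous_mult: "continuous_map (prod_topology P P) P \<mu>"
    and pointed_mult: "\<mu> (p0, p0) = p0"
    and continuous_inv: "continuous_map P P \<eta>"
    and pointed_inv: "\<eta> p0 = p0"
    and right_unit: "homotopic_with (\<lambda>h. h p0 = p0) P P (\<lambda>x. \<mu> (x, p0)) (\<lambda>x. x)"
    and left_unit: "homotopic_with (\<lambda>h. h p0 = p0) P P (\<lambda>x. \<mu> (p0, x)) (\<lambda>x. x)"
    and left_inverse: "homotopic_with (\<lambda>h. h p0 = p0) P P (\<lambda>x. \<mu> (\<eta> x, x)) (\<lambda>x. p0)"
    and right_inverse: "homotopic_with (\<lambda>h. h p0 = p0) P P (\<lambda>x. \<mu> (x, \<eta> x)) (\<lambda>x. p0)"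
    and assoc: "homotopic_with (\<lambda>h. h (p0, p0, p0) = p0)
      (prod_topology P (prod_topology P P)) P
      (\<lambda>(x, y, z). \<mu> (\<mu> (x, y), z)) (\<lambda>(x, y, z). \<mu> (x, \<mu> (y, z)))"

definition path_in :: "'a topology \<Rightarrow> 'a \<Rightarrow> 'a set \<Rightarrow> bool" where
  "path_in P g A \<longleftrightarrow> (\<exists>a\<in>A. path_component_of P g a)"

definition H_lcoset :: "'a topology \<Rightarrow> ('a \<times> 'a \<Rightarrow> 'a) \<Rightarrow> ('a \<Rightarrow> 'a) \<Rightarrow> 'a \<Rightarrow> 'a set \<Rightarrow> 'a set" where
  "H_lcoset P \<mu> \<eta> g A = {g' \<in> topspace P. path_in P (\<mu> (\<eta> g, g')) A}"

definition H_center :: "'a topology \<Rightarrow> ('a \<times> 'a \<Rightarrow> 'a) \<Rightarrow> 'a set" where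
  "H_center P \<mu> =
    {g \<in> topspace P. homotopic_with (\<lambda>_. True) P P (\<lambda>x. \<mu> (g, x)) (\<lambda>x. \<mu> (x, g))}"

text \<open>The products below are defined on representatives: the union runs over all choices of
  representatives, so it is the stated class as soon as the product is well defined, and
  otherwise a union of several distinct classes.\<close>

definition H_quotient ::
  "'a topology \<Rightarrow> 'a \<Rightarrow> ('a \<times> 'a \<Rightarrow> 'a) \<Rightarrow> ('a \<Rightarrow> 'a) \<Rightarrow> 'a set \<Rightarrow> 'a set monoid" where
  "H_quotient P p0 \<mu> \<eta> A =
    \<lparr>carrier = {H_lcoset P \<mu> \<eta> g A | g. g \<in> topspace P},
     mult = (\<lambda>C D. \<Union>{H_lcoset P \<mu> \<eta> (\<mu> (g, h)) A | g h.
       g \<in> topspace P \<and> h \<in> topspace P \<and> C = H_lcoset P \<mu> \<eta> g A \<and> D = H_lcoset P \<mu> \<eta> h A}),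
     one = H_lcoset P \<mu> \<eta> p0 A\<rparr>"

definition H_conj :: "('a \<times> 'a \<Rightarrow> 'a) \<Rightarrow> ('a \<Rightarrow> 'a) \<Rightarrow> 'a \<Rightarrow> 'a \<Rightarrow> 'a" where
  "H_conj \<mu> \<eta> a = (\<lambda>g. \<mu> (a, \<mu> (g, \<eta> a)))"

text \<open>Free homotopy class of a self-map of \<open>P\<close>. Values outside \<open>topspace P\<close> are irrelevant:
  maps that agree on \<open>topspace P\<close> have the same class.\<close>

definition homotopy_class :: "'a topology \<Rightarrow> ('a \<Rightarrow> 'a) \<Rightarrow> ('a \<Rightarrow> 'a) set" where
  "homotopy_class P f = {h. homotopic_with (\<lambda>_. True) P P f h}"

definition HInn ::
  "'a topology \<Rightarrow> 'a \<Rightarrow> ('a \<times> 'a \<Rightarrow> 'a) \<Rightarrow> ('a \<Rightarrow> 'a) \<Rightarrow> ('a \<Rightarrow> 'a) set monoid" where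
  "HInn P p0 \<mu> \<eta> =
    \<lparr>carrier = {homotopy_class P (H_conj \<mu> \<eta> a) | a. a \<in> topspace P},
     mult = (\<lambda>F G. \<Union>{homotopy_class P (H_conj \<mu> \<eta> (\<mu> (a, b))) | a b.
       a \<in> topspace P \<and> b \<in> topspace P \<and>
       F = homotopy_class P (H_conj \<mu> \<eta> a) \<and> G = homotopy_class P (H_conj \<mu> \<eta> b)}),
     one = homotopy_class P (H_conj \<mu> \<eta> p0)\<rparr>"

end

theory Submission
  imports Defs
begin

text \<open>The free homotopy classes of self-maps of \<open>P\<close> form a group under the pointwise product. In
  it the class of \<open>\<phi>\<^sub>a\<close> is the conjugate of the class of the identity map by the class \<open>c\<^sub>a\<close> of the
  constant map at \<open>a\<close>. Hence \<open>\<phi>\<^sub>g \<simeq> \<phi>\<^sub>h\<close> holds iff \<open>c\<^sub>g\<^sup>-\<^sup>1 c\<^sub>h\<close>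
  commutes with the class of the identity map, that is, iff \<open>g\<^sup>-\<^sup>1.h\<close> lies in the center. So the
  cosets of the center are exactly the fibres of \<open>a \<mapsto> [\<phi>\<^sub>a]\<close>. Since \<open>\<phi>\<^sub>a \<circ> \<phi>\<^sub>b \<simeq> \<phi>\<^bsub>a.b\<^esub>\<close>,
  the product of classes is well defined, and sending a class to its fibre is an isomorphism.\<close>

section \<open>Homotopies of pairs, homotopy classes, and conjugation in a group\<close>

lemma homotopic_with_Pair:
  assumes "homotopic_with (\<lambda>_. True) X Y f f'" "homotopic_with (\<lambda>_. True) X Z g g'"
  shows "homotopic_with (\<lambda>_. True) X (prod_topology Y Z) (\<lambda>x. (f x, g x)) (\<lambda>x. (f' x, g' x))"
proof -
  have "homotopic_with (\<lambda>_. True) (prod_topology X X) (prod_topology Y Z)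
      (\<lambda>z. (f (fst z), g (snd z))) (\<lambda>z. (f' (fst z), g' (snd z)))"
    by (rule homotopic_with_prod_topology[OF assms]) simp
  \<comment> \<open>The product homotopy starts from \<open>X \<times> X\<close>; the diagonal pulls
    it back to \<open>X\<close>.\<close>
  moreover have "continuous_map X (prod_topology X X) (\<lambda>x. (x, x))"
    by (simp add: continuous_map_pairwise o_def)
  ultimately show ?thesis
    using homotopic_with_compose_continuous_map_right[where q = "\<lambda>_. True"] by (force simp: o_def)
qed

lemma homotopy_class_eq_iff:
  assumes "continuous_map P P f" "continuous_map P P g"
  shows "homotopy_class P f = homotopy_class P g \<longleftrightarrow> homotopic_with (\<lambda>_. True) P P f g"
proof
  assume "homotopy_class P f = homotopy_class P g"
  \<comment> \<open>Reflexivity of \<open>homotopic_with\<close> amounts to continuity; the class of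
    a discontinuous map is empty.\<close>
  moreover have "g \<in> homotopy_class P g"
    using assms by (simp add: homotopy_class_def)
  ultimately show "homotopic_with (\<lambda>_. True) P P f g"
    by (auto simp: homotopy_class_def)
next
  assume fg: "homotopic_with (\<lambda>_. True) P P f g"
  then show "homotopy_class P f = homotopy_class P g"
    unfolding homotopy_class_def
    by (blast intro: homotopic_with_trans homotopic_with_symD)
qed

text \<open>Multiply by \<open>inv a\<close> on the left and by \<open>b\<close> on the right. In
  the application \<open>x\<close> is the class of the identity map and \<open>a\<close>,
  \<open>b\<close> are classes of constant maps.\<close>

lemma (in group) conj_eq_iff_commute:
  assumes "a \<in> carrier G" "b \<in> carrier G" "x \<in> carrier G"
  shows "a \<otimes> (x \<otimes> inv a) = b \<otimes> (x \<otimes> inv b) \<longleftrightarrow> (inv a \<otimes> b) \<otimes> x = x \<otimes> (inv a \<otimes> b)"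
proof -
  have "a \<otimes> (x \<otimes> inv a) = b \<otimes> (x \<otimes> inv b)
    \<longleftrightarrow> inv a \<otimes> (a \<otimes> (x \<otimes> inv a)) \<otimes> b = inv a \<otimes> (b \<otimes> (x \<otimes> inv b)) \<otimes> b"
    using assms by simp
  also have "inv a \<otimes> (a \<otimes> (x \<otimes> inv a)) \<otimes> b = x \<otimes> (inv a \<otimes> b)"
    using assms by (simp add: m_assoc inv_solve_left')
  also have "inv a \<otimes> (b \<otimes> (x \<otimes> inv b)) \<otimes> b = (inv a \<otimes> b) \<otimes> x"
    using assms by (simp add: m_assoc)
  finally show ?thesis by auto
qed

section \<open>The group of free homotopy classes of self-maps\<close>

context H_group
begin

text \<open>The product collects every map homotopic to a product of representatives, so none has to
  be chosen; \<open>self_map_classes_mult\<close> shows that this is a single class.\<close>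

definition self_map_classes :: "('a \<Rightarrow> 'a) set monoid" where
  "self_map_classes =
    \<lparr>carrier = {homotopy_class P f | f. continuous_map P P f},
     mult = (\<lambda>C D. {h. \<exists>f\<in>C. \<exists>g\<in>D. homotopic_with (\<lambda>_. True) P P (\<lambda>x. \<mu> (f x, g x)) h}),
     one = homotopy_class P (\<lambda>_. p0)\<rparr>"

lemma homotopic_mult:
  assumes "homotopic_with (\<lambda>_. True) P P f f'" "homotopic_with (\<lambda>_. True) P P g g'"
  shows "homotopic_with (\<lambda>_. True) P P (\<lambda>x. \<mu> (f x, g x)) (\<lambda>x. \<mu> (f' x, g' x))"
  using homotopic_with_compose_continuous_map_left
    [OF homotopic_with_Pair[OF assms] continuous_mult, where q = "\<lambda>_. True"]
  by (simp add: o_def)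

lemma continuous_map_mult:
  assumes "continuous_map P P f" "continuous_map P P g"
  shows "continuous_map P P (\<lambda>x. \<mu> (f x, g x))"
  \<comment> \<open>Being continuous is the same as being homotopic to itself.\<close>
  using homotopic_mult[of f f g g] assms by simp

lemma continuous_map_inv:
  assumes "continuous_map P P f"
  shows "continuous_map P P (\<lambda>x. \<eta> (f x))"
  using continuous_map_compose[OF assms continuous_inv] by (simp add: o_def)

lemma mult_in_topspace: "a \<in> topspace P \<Longrightarrow> b \<in> topspace P \<Longrightarrow> \<mu> (a, b) \<in> topspace P"
  using continuous_map_image_subset_topspace[OF continuous_mult] by auto

lemma inv_in_topspace: "a \<in> topspace P \<Longrightarrow> \<eta> a \<in> topspace P"
  using continuous_map_image_subset_topspace[OF continuous_inv] by auto

text \<open>By \<open>homotopic_mult\<close>, a change of representatives moves the pointwise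
  product only within its homotopy class.\<close>

lemma self_map_classes_mult:
  assumes "continuous_map P P f" "continuous_map P P g"
  shows "homotopy_class P f \<otimes>\<^bsub>self_map_classes\<^esub> homotopy_class P g = homotopy_class P (\<lambda>x. \<mu> (f x, g x))"
proof -
  have "homotopic_with (\<lambda>_. True) P P (\<lambda>x. \<mu> (f x, g x)) h"
    if "homotopic_with (\<lambda>_. True) P P f f'" "homotopic_with (\<lambda>_. True) P P g g'"
      "homotopic_with (\<lambda>_. True) P P (\<lambda>x. \<mu> (f' x, g' x)) h" for f' g' h
    using homotopic_with_trans[OF homotopic_mult[OF that(1,2)] that(3)] .
  moreover have "homotopic_with (\<lambda>_. True) P P f f" "homotopic_with (\<lambda>_. True) P P g g"
    using assms by simp_all
  ultimately show ?thesis
    unfolding self_map_classes_def homotopy_class_def by (simp, blast)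
qed

lemma self_map_classes_closed:
  "continuous_map P P f \<Longrightarrow> homotopy_class P f \<in> carrier self_map_classes"
  by (auto simp: self_map_classes_def)

text \<open>This turns the pointed homotopies of the H-group axioms into free ones: \<open>f\<close>
  may move the base point, so the property \<open>q\<close> is dropped after precomposition.\<close>

lemma homotopic_compose_self_map:
  assumes "homotopic_with q P P u v" "continuous_map P P f"
  shows "homotopic_with (\<lambda>_. True) P P (\<lambda>x. u (f x)) (\<lambda>x. v (f x))"
  using homotopic_with_compose_continuous_map_right[OF assms, where q = "\<lambda>_. True"]
  by (simp add: o_def)

lemma self_map_classes_left_inverse:
  assumes "continuous_map P P f"
  shows "homotopy_class P (\<lambda>x. \<eta> (f x)) \<otimes>\<^bsub>self_map_classes\<^esub> homotopy_class P f = \<one>\<^bsub>self_map_classes\<^esub>"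
proof -
  have "homotopic_with (\<lambda>_. True) P P (\<lambda>x. \<mu> (\<eta> (f x), f x)) (\<lambda>_. p0)"
    by (rule homotopic_compose_self_map[OF left_inverse assms])
  then have "homotopy_class P (\<lambda>x. \<mu> (\<eta> (f x), f x)) = homotopy_class P (\<lambda>_. p0)"
    using homotopy_class_eq_iff homotopic_with_imp_continuous_maps by blast
  then show ?thesis
    unfolding self_map_classes_mult[OF continuous_map_inv[OF assms] assms]
    by (simp add: self_map_classes_def)
qed

lemma group_self_map_classes: "group self_map_classes"
proof (rule groupI)
  show "\<one>\<^bsub>self_map_classes\<^esub> \<in> carrier self_map_classes"
    using base_point by (auto simp: self_map_classes_def)
next
  fix C D assume "C \<in> carrier self_map_classes" "D \<in> carrier self_map_classes"
  then show "C \<otimes>\<^bsub>self_map_classes\<^esub> D \<in> carrier self_map_classes"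
    using self_map_classes_mult self_map_classes_closed continuous_map_mult
    by (fastforce simp: self_map_classes_def)
next
  fix C D E
  assume "C \<in> carrier self_map_classes" "D \<in> carrier self_map_classes" "E \<in> carrier self_map_classes"
  then obtain f g h where f: "C = homotopy_class P f" "continuous_map P P f"
    and g: "D = homotopy_class P g" "continuous_map P P g"
    and h: "E = homotopy_class P h" "continuous_map P P h"
    by (auto simp: self_map_classes_def)
  \<comment> \<open>The associativity homotopy on triples is pulled back along this map to one
    between self-maps of \<open>P\<close>.\<close>
  have "continuous_map P (prod_topology P (prod_topology P P)) (\<lambda>x. (f x, g x, h x))"
    using f g h by (intro continuous_map_pairedI)
  from homotopic_with_compose_continuous_map_right[OF assoc this, where q = "\<lambda>_. True"]
  have "homotopic_with (\<lambda>_. True) P P (\<lambda>x. \<mu> (\<mu> (f x, g x), h x)) (\<lambda>x. \<mu> (f x, \<mu> (g x, h x)))"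
    by (simp add: o_def)
  then show "C \<otimes>\<^bsub>self_map_classes\<^esub> D \<otimes>\<^bsub>self_map_classes\<^esub> E
      = C \<otimes>\<^bsub>self_map_classes\<^esub> (D \<otimes>\<^bsub>self_map_classes\<^esub> E)"
    by (simp add: f g h self_map_classes_mult continuous_map_mult homotopy_class_eq_iff)
next
  fix C assume "C \<in> carrier self_map_classes"
  then obtain f where f: "C = homotopy_class P f" "continuous_map P P f"
    by (auto simp: self_map_classes_def)
  have "homotopic_with (\<lambda>_. True) P P (\<lambda>x. \<mu> (p0, f x)) f"
    using homotopic_compose_self_map[OF left_unit f(2)] by simp
  moreover have "\<one>\<^bsub>self_map_classes\<^esub> = homotopy_class P (\<lambda>_. p0)"
    by (simp add: self_map_classes_def)
  ultimately show "\<one>\<^bsub>self_map_classes\<^esub> \<otimes>\<^bsub>self_map_classes\<^esub> C = C"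
    using base_point by (simp add: f self_map_classes_mult continuous_map_mult homotopy_class_eq_iff)
  show "\<exists>D\<in>carrier self_map_classes. D \<otimes>\<^bsub>self_map_classes\<^esub> C = \<one>\<^bsub>self_map_classes\<^esub>"
    using self_map_classes_left_inverse[OF f(2)] f continuous_map_inv self_map_classes_closed by blast
qed

sublocale self_maps: group self_map_classes
  by (rule group_self_map_classes)

section \<open>Classes of constant maps, of the identity and of conjugations\<close>

abbreviation const_class :: "'a \<Rightarrow> ('a \<Rightarrow> 'a) set" where
  "const_class a \<equiv> homotopy_class P (\<lambda>_. a)"

abbreviation id_class :: "('a \<Rightarrow> 'a) set" where
  "id_class \<equiv> homotopy_class P (\<lambda>x. x)"

lemma const_class_closed: "a \<in> topspace P \<Longrightarrow> const_class a \<in> carrier self_map_classes"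
  by (simp add: self_map_classes_closed)

lemma id_class_closed: "id_class \<in> carrier self_map_classes"
  by (simp add: self_map_classes_closed)

lemma const_class_mult:
  assumes "a \<in> topspace P" "b \<in> topspace P"
  shows "const_class (\<mu> (a, b)) = const_class a \<otimes>\<^bsub>self_map_classes\<^esub> const_class b"
  using assms by (simp add: self_map_classes_mult)

lemma const_class_inv:
  assumes "a \<in> topspace P"
  shows "const_class (\<eta> a) = inv\<^bsub>self_map_classes\<^esub> (const_class a)"
  using self_map_classes_left_inverse[of "\<lambda>_. a"] assms inv_in_topspace
  by (intro self_maps.inv_equality[symmetric] const_class_closed) auto

text \<open>A path from \<open>a\<close> to \<open>b\<close> is a homotopy between the two constant
  maps.\<close>

lemma const_class_eq:
  assumes "path_component_of P a b"
  shows "const_class a = const_class b"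
proof -
  have "a \<in> topspace P" "b \<in> topspace P"
    using assms path_component_in_topspace by metis+
  then show ?thesis
    using assms by (simp add: homotopy_class_eq_iff homotopic_constant_maps)
qed

lemma conj_continuous:
  assumes "a \<in> topspace P"
  shows "continuous_map P P (H_conj \<mu> \<eta> a)"
  unfolding H_conj_def using assms inv_in_topspace by (intro continuous_map_mult) auto

lemma conj_class:
  assumes "a \<in> topspace P"
  shows "homotopy_class P (H_conj \<mu> \<eta> a)
    = const_class a \<otimes>\<^bsub>self_map_classes\<^esub> (id_class \<otimes>\<^bsub>self_map_classes\<^esub> inv\<^bsub>self_map_classes\<^esub> (const_class a))"
  using assms inv_in_topspace
  by (simp add: H_conj_def self_map_classes_mult continuous_map_mult flip: const_class_inv)

text \<open>The maps \<open>\<mu>(g,-)\<close> and \<open>\<mu>(-,g)\<close> are the pointwise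
  products, in the two orders, of the constant map at \<open>g\<close> and the identity map.\<close>

lemma mem_center_iff:
  "g \<in> H_center P \<mu> \<longleftrightarrow> g \<in> topspace P \<and>
    const_class g \<otimes>\<^bsub>self_map_classes\<^esub> id_class = id_class \<otimes>\<^bsub>self_map_classes\<^esub> const_class g"
proof (cases "g \<in> topspace P")
  case True
  then show ?thesis
    by (simp add: H_center_def self_map_classes_mult continuous_map_mult homotopy_class_eq_iff)
qed (simp add: H_center_def)

section \<open>Cosets of the center as fibres of the conjugation classes\<close>

lemma lcoset_center:
  assumes g: "g \<in> topspace P"
  shows "H_lcoset P \<mu> \<eta> g (H_center P \<mu>)
    = {a \<in> topspace P. homotopy_class P (H_conj \<mu> \<eta> a) = homotopy_class P (H_conj \<mu> \<eta> g)}"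
proof -
  have "path_in P (\<mu> (\<eta> g, a)) (H_center P \<mu>)
      \<longleftrightarrow> homotopy_class P (H_conj \<mu> \<eta> a) = homotopy_class P (H_conj \<mu> \<eta> g)"
    if a: "a \<in> topspace P" for a
  proof -
    have top: "\<mu> (\<eta> g, a) \<in> topspace P"
      using a g mult_in_topspace inv_in_topspace by blast
    \<comment> \<open>The center is a union of path components: by \<open>mem_center_iff\<close>,
      membership of a point of \<open>P\<close> depends only on its constant class, which is the
      same along a path.\<close>
    have "path_in P (\<mu> (\<eta> g, a)) (H_center P \<mu>) \<longleftrightarrow> \<mu> (\<eta> g, a) \<in> H_center P \<mu>"
    proof
      assume "path_in P (\<mu> (\<eta> g, a)) (H_center P \<mu>)"
      then obtain z where "z \<in> H_center P \<mu>" "const_class (\<mu> (\<eta> g, a)) = const_class z"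
        using const_class_eq unfolding path_in_def by blast
      then show "\<mu> (\<eta> g, a) \<in> H_center P \<mu>"
        using top by (simp add: mem_center_iff)
    next
      assume "\<mu> (\<eta> g, a) \<in> H_center P \<mu>"
      then show "path_in P (\<mu> (\<eta> g, a)) (H_center P \<mu>)"
        unfolding path_in_def using top by (intro bexI[of _ "\<mu> (\<eta> g, a)"]) (simp_all add: path_component_of_refl)
    qed
    \<comment> \<open>The constant class of \<open>\<mu> (\<eta> g, a)\<close> is the inverse of
      \<open>const_class g\<close> times \<open>const_class a\<close>; it commutes with
      \<open>id_class\<close> exactly when both conjugates of \<open>id_class\<close> agree.\<close>
    also have "\<dots> \<longleftrightarrow> homotopy_class P (H_conj \<mu> \<eta> g) = homotopy_class P (H_conj \<mu> \<eta> a)"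
      unfolding conj_class[OF a] conj_class[OF g]
      using self_maps.conj_eq_iff_commute[OF const_class_closed[OF g] const_class_closed[OF a] id_class_closed]
      by (simp add: mem_center_iff top a g const_class_mult const_class_inv inv_in_topspace)
    finally show ?thesis by auto
  qed
  then show ?thesis
    unfolding H_lcoset_def by (intro Collect_cong conj_cong refl)
qed

lemma lcoset_center_eq_iff:
  assumes "g \<in> topspace P" "h \<in> topspace P"
  shows "H_lcoset P \<mu> \<eta> g (H_center P \<mu>) = H_lcoset P \<mu> \<eta> h (H_center P \<mu>)
    \<longleftrightarrow> homotopy_class P (H_conj \<mu> \<eta> g) = homotopy_class P (H_conj \<mu> \<eta> h)"
proof
  assume eq: "H_lcoset P \<mu> \<eta> g (H_center P \<mu>) = H_lcoset P \<mu> \<eta> h (H_center P \<mu>)"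
  \<comment> \<open>Equal fibres share the point \<open>g\<close>, which forces equal
    values.\<close>
  have "g \<in> H_lcoset P \<mu> \<eta> g (H_center P \<mu>)"
    unfolding lcoset_center[OF assms(1)] using assms(1) by simp
  then have "g \<in> H_lcoset P \<mu> \<eta> h (H_center P \<mu>)"
    unfolding eq .
  then show "homotopy_class P (H_conj \<mu> \<eta> g) = homotopy_class P (H_conj \<mu> \<eta> h)"
    unfolding lcoset_center[OF assms(2)] by simp
next
  assume eq: "homotopy_class P (H_conj \<mu> \<eta> g) = homotopy_class P (H_conj \<mu> \<eta> h)"
  show "H_lcoset P \<mu> \<eta> g (H_center P \<mu>) = H_lcoset P \<mu> \<eta> h (H_center P \<mu>)"
    unfolding lcoset_center[OF assms(1)] lcoset_center[OF assms(2)] eq ..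
qed

section \<open>Well-defined products of conjugation classes and of cosets\<close>

lemma conj_mult:
  assumes "a \<in> topspace P" "b \<in> topspace P"
  shows "homotopic_with (\<lambda>_. True) P P (H_conj \<mu> \<eta> (\<mu> (a, b))) (H_conj \<mu> \<eta> a \<circ> H_conj \<mu> \<eta> b)"
proof -
  \<comment> \<open>Since \<open>a\<close> and \<open>\<eta> a\<close> are constants, the composite
    is also a pointwise product, which can be computed in \<open>self_map_classes\<close>.\<close>
  have eq: "H_conj \<mu> \<eta> a \<circ> H_conj \<mu> \<eta> b = (\<lambda>x. \<mu> (a, \<mu> (H_conj \<mu> \<eta> b x, \<eta> a)))"
    by (simp add: H_conj_def o_def)
  have "homotopy_class P (H_conj \<mu> \<eta> a \<circ> H_conj \<mu> \<eta> b)
    = const_class a \<otimes>\<^bsub>self_map_classes\<^esub> (homotopy_class P (H_conj \<mu> \<eta> b) \<otimes>\<^bsub>self_map_classes\<^esub> const_class (\<eta> a))"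
    using assms by (simp add: eq self_map_classes_mult continuous_map_mult inv_in_topspace conj_continuous)
  \<comment> \<open>The inverse of a product reverses the factors; this is the group law for
    classes, applied to \<open>const_class a\<close> and \<open>const_class b\<close>.\<close>
  also have "\<dots> = homotopy_class P (H_conj \<mu> \<eta> (\<mu> (a, b)))"
    using assms by (simp add: conj_class mult_in_topspace const_class_mult const_class_inv
        const_class_closed id_class_closed self_maps.inv_mult_group self_maps.m_assoc)
  finally show ?thesis
    using homotopy_class_eq_iff[OF conj_continuous[OF mult_in_topspace[OF assms]]
        continuous_map_compose[OF conj_continuous conj_continuous], OF assms(2,1)]
    by (simp only: simp_thms)
qed

text \<open>A conjugation class does not determine the constant class, so the argument passes
  through composition of maps: it respects homotopy, and \<open>conj_mult\<close> relates it to the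
  product of indices.\<close>

lemma conj_class_mult_cong:
  assumes "a \<in> topspace P" "b \<in> topspace P" "a' \<in> topspace P" "b' \<in> topspace P"
    and "homotopy_class P (H_conj \<mu> \<eta> a) = homotopy_class P (H_conj \<mu> \<eta> a')"
    and "homotopy_class P (H_conj \<mu> \<eta> b) = homotopy_class P (H_conj \<mu> \<eta> b')"
  shows "homotopy_class P (H_conj \<mu> \<eta> (\<mu> (a, b))) = homotopy_class P (H_conj \<mu> \<eta> (\<mu> (a', b')))"
proof -
  have "homotopic_with (\<lambda>_. True) P P (H_conj \<mu> \<eta> a) (H_conj \<mu> \<eta> a')"
    using assms(5) homotopy_class_eq_iff[OF conj_continuous[OF assms(1)] conj_continuous[OF assms(3)]]
    by (rule iffD1[rotated])
  moreover have "homotopic_with (\<lambda>_. True) P P (H_conj \<mu> \<eta> b) (H_conj \<mu> \<eta> b')"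
    using assms(6) homotopy_class_eq_iff[OF conj_continuous[OF assms(2)] conj_continuous[OF assms(4)]]
    by (rule iffD1[rotated])
  ultimately have "homotopic_with (\<lambda>_. True) P P (H_conj \<mu> \<eta> a \<circ> H_conj \<mu> \<eta> b) (H_conj \<mu> \<eta> a' \<circ> H_conj \<mu> \<eta> b')"
    by (rule homotopic_compose[rotated])
  from homotopic_with_trans[OF homotopic_with_trans[OF conj_mult[OF assms(1,2)] this]
      homotopic_with_symD[OF conj_mult[OF assms(3,4)]]]
  show ?thesis
    using homotopy_class_eq_iff[OF conj_continuous[OF mult_in_topspace[OF assms(1,2)]]
        conj_continuous[OF mult_in_topspace[OF assms(3,4)]]] by (rule iffD2[rotated])
qed

text \<open>By \<open>conj_class_mult_cong\<close> the family in the defining union has a single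
  member.\<close>

lemma HInn_mult:
  assumes "a \<in> topspace P" "b \<in> topspace P"
  shows "homotopy_class P (H_conj \<mu> \<eta> a) \<otimes>\<^bsub>HInn P p0 \<mu> \<eta>\<^esub> homotopy_class P (H_conj \<mu> \<eta> b)
    = homotopy_class P (H_conj \<mu> \<eta> (\<mu> (a, b)))"
proof -
  have "{homotopy_class P (H_conj \<mu> \<eta> (\<mu> (a', b'))) | a' b'. a' \<in> topspace P \<and> b' \<in> topspace P \<and>
      homotopy_class P (H_conj \<mu> \<eta> a) = homotopy_class P (H_conj \<mu> \<eta> a') \<and>
      homotopy_class P (H_conj \<mu> \<eta> b) = homotopy_class P (H_conj \<mu> \<eta> b')}
    = {homotopy_class P (H_conj \<mu> \<eta> (\<mu> (a, b)))}"
    using assms conj_class_mult_cong by blast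
  then show ?thesis unfolding HInn_def monoid.select_convs by (simp only: ccpo_Sup_singleton)
qed

text \<open>Equality of cosets translates into equality of conjugation classes, so the family in
  this union is a singleton too.\<close>

lemma quotient_center_mult:
  assumes "g \<in> topspace P" "h \<in> topspace P"
  shows "H_lcoset P \<mu> \<eta> g (H_center P \<mu>) \<otimes>\<^bsub>H_quotient P p0 \<mu> \<eta> (H_center P \<mu>)\<^esub> H_lcoset P \<mu> \<eta> h (H_center P \<mu>)
    = H_lcoset P \<mu> \<eta> (\<mu> (g, h)) (H_center P \<mu>)"
proof -
  have "H_lcoset P \<mu> \<eta> (\<mu> (g', h')) (H_center P \<mu>) = H_lcoset P \<mu> \<eta> (\<mu> (g, h)) (H_center P \<mu>)"
    if "g' \<in> topspace P" "h' \<in> topspace P"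
      "H_lcoset P \<mu> \<eta> g (H_center P \<mu>) = H_lcoset P \<mu> \<eta> g' (H_center P \<mu>)"
      "H_lcoset P \<mu> \<eta> h (H_center P \<mu>) = H_lcoset P \<mu> \<eta> h' (H_center P \<mu>)" for g' h'
    using that assms conj_class_mult_cong[of g' h' g h]
    by (simp add: lcoset_center_eq_iff mult_in_topspace)
  then have "{H_lcoset P \<mu> \<eta> (\<mu> (g', h')) (H_center P \<mu>) | g' h'. g' \<in> topspace P \<and> h' \<in> topspace P \<and>
      H_lcoset P \<mu> \<eta> g (H_center P \<mu>) = H_lcoset P \<mu> \<eta> g' (H_center P \<mu>) \<and>
      H_lcoset P \<mu> \<eta> h (H_center P \<mu>) = H_lcoset P \<mu> \<eta> h' (H_center P \<mu>)}
    = {H_lcoset P \<mu> \<eta> (\<mu> (g, h)) (H_center P \<mu>)}"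
    using assms by blast
  then show ?thesis unfolding H_quotient_def monoid.select_convs by (simp only: ccpo_Sup_singleton)
qed

section \<open>The two groups and their isomorphism\<close>

lemma group_HInn: "group (HInn P p0 \<mu> \<eta>)"
proof (rule groupI)
  have carrier: "C \<in> carrier (HInn P p0 \<mu> \<eta>) \<longleftrightarrow> (\<exists>a\<in>topspace P. C = homotopy_class P (H_conj \<mu> \<eta> a))" for C
    by (auto simp: HInn_def)
  have one: "\<one>\<^bsub>HInn P p0 \<mu> \<eta>\<^esub> = homotopy_class P (H_conj \<mu> \<eta> p0)"
    by (simp add: HInn_def)
  have const_one: "const_class p0 = \<one>\<^bsub>self_map_classes\<^esub>"
    by (simp add: self_map_classes_def)
  show "\<one>\<^bsub>HInn P p0 \<mu> \<eta>\<^esub> \<in> carrier (HInn P p0 \<mu> \<eta>)"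
    using base_point by (auto simp: carrier one)
  fix C assume "C \<in> carrier (HInn P p0 \<mu> \<eta>)"
  then obtain a where a: "a \<in> topspace P" "C = homotopy_class P (H_conj \<mu> \<eta> a)"
    by (auto simp: carrier)
  \<comment> \<open>The points \<open>\<mu> (p0, a)\<close> and \<open>a\<close> may differ, but
    their constant classes agree, and by \<open>conj_class\<close> these determine the conjugation
    classes.\<close>
  show "\<one>\<^bsub>HInn P p0 \<mu> \<eta>\<^esub> \<otimes>\<^bsub>HInn P p0 \<mu> \<eta>\<^esub> C = C"
    unfolding one a(2) HInn_mult[OF base_point a(1)]
    using a(1) base_point by (simp add: conj_class mult_in_topspace const_class_mult const_one const_class_closed)
  have "homotopy_class P (H_conj \<mu> \<eta> (\<eta> a)) \<otimes>\<^bsub>HInn P p0 \<mu> \<eta>\<^esub> C = \<one>\<^bsub>HInn P p0 \<mu> \<eta>\<^esub>"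
    unfolding one a(2) HInn_mult[OF inv_in_topspace[OF a(1)] a(1)]
    using a(1) base_point by (simp add: conj_class mult_in_topspace inv_in_topspace const_class_mult
        const_class_inv const_one const_class_closed)
  then show "\<exists>D\<in>carrier (HInn P p0 \<mu> \<eta>). D \<otimes>\<^bsub>HInn P p0 \<mu> \<eta>\<^esub> C = \<one>\<^bsub>HInn P p0 \<mu> \<eta>\<^esub>"
    using carrier inv_in_topspace[OF a(1)] by blast
  fix D assume "D \<in> carrier (HInn P p0 \<mu> \<eta>)"
  then obtain b where b: "b \<in> topspace P" "D = homotopy_class P (H_conj \<mu> \<eta> b)"
    by (auto simp: carrier)
  show "C \<otimes>\<^bsub>HInn P p0 \<mu> \<eta>\<^esub> D \<in> carrier (HInn P p0 \<mu> \<eta>)"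
    using a b mult_in_topspace by (auto simp: carrier HInn_mult)
  fix E assume "E \<in> carrier (HInn P p0 \<mu> \<eta>)"
  then obtain c where c: "c \<in> topspace P" "E = homotopy_class P (H_conj \<mu> \<eta> c)"
    by (auto simp: carrier)
  show "C \<otimes>\<^bsub>HInn P p0 \<mu> \<eta>\<^esub> D \<otimes>\<^bsub>HInn P p0 \<mu> \<eta>\<^esub> E
      = C \<otimes>\<^bsub>HInn P p0 \<mu> \<eta>\<^esub> (D \<otimes>\<^bsub>HInn P p0 \<mu> \<eta>\<^esub> E)"
    \<comment> \<open>First both products become conjugation classes of the two bracketings of
      \<open>a\<close>, \<open>b\<close>, \<open>c\<close>; then associativity for constant classes
      identifies them.\<close>
    using a b c by (simp add: HInn_mult mult_in_topspace)
      (simp add: mult_in_topspace conj_class const_class_mult const_class_closed self_maps.m_assoc)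
qed

lemma HInn_iso_quotient_center:
  "(\<lambda>C. {a \<in> topspace P. homotopy_class P (H_conj \<mu> \<eta> a) = C})
    \<in> iso (HInn P p0 \<mu> \<eta>) (H_quotient P p0 \<mu> \<eta> (H_center P \<mu>))" (is "?h \<in> iso ?I ?Q")
proof (rule isoI)
  have fibre: "?h (homotopy_class P (H_conj \<mu> \<eta> g)) = H_lcoset P \<mu> \<eta> g (H_center P \<mu>)"
    if "g \<in> topspace P" for g
    using that by (simp add: lcoset_center)
  have carrier: "carrier ?I = (\<lambda>a. homotopy_class P (H_conj \<mu> \<eta> a)) ` topspace P"
    "carrier ?Q = (\<lambda>a. H_lcoset P \<mu> \<eta> a (H_center P \<mu>)) ` topspace P"
    by (auto simp: HInn_def H_quotient_def)
  show "?h \<in> hom ?I ?Q"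
  proof (rule homI)
    fix C assume "C \<in> carrier ?I"
    then show "?h C \<in> carrier ?Q"
      using fibre by (auto simp: carrier)
  next
    fix C D assume "C \<in> carrier ?I" "D \<in> carrier ?I"
    then obtain a b where a: "a \<in> topspace P" "C = homotopy_class P (H_conj \<mu> \<eta> a)"
      and b: "b \<in> topspace P" "D = homotopy_class P (H_conj \<mu> \<eta> b)"
      by (auto simp: carrier)
    show "?h (C \<otimes>\<^bsub>?I\<^esub> D) = ?h C \<otimes>\<^bsub>?Q\<^esub> ?h D"
      unfolding a(2) b(2) HInn_mult[OF a(1) b(1)] fibre[OF a(1)] fibre[OF b(1)]
        fibre[OF mult_in_topspace[OF a(1) b(1)]] quotient_center_mult[OF a(1) b(1)] ..
  qed
  show "bij_betw ?h (carrier ?I) (carrier ?Q)"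
  proof (rule bij_betw_imageI)
    \<comment> \<open>Each class in the carrier has a nonempty fibre, and any point of the fibre
      recovers the class.\<close>
    show "inj_on ?h (carrier ?I)"
      by (intro inj_onI) (auto simp: carrier)
    show "?h ` carrier ?I = carrier ?Q"
      unfolding carrier image_image using fibre by (intro image_cong) auto
  qed
qed

text \<open>The group laws are transported from \<open>HInn\<close> along the fibre map.\<close>

lemma group_quotient_center: "group (H_quotient P p0 \<mu> \<eta> (H_center P \<mu>))" (is "group ?Q")
proof -
  let ?h = "\<lambda>C. {a \<in> topspace P. homotopy_class P (H_conj \<mu> \<eta> a) = C}"
  let ?I = "HInn P p0 \<mu> \<eta>"
  \<comment> \<open>The image of a group under a homomorphism is a group on the image carrier, with
    the image of the unit as unit. This equation and the next identify that structure with
    \<open>?Q\<close>.\<close>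
  have "?h ` carrier ?I = carrier ?Q"
    using HInn_iso_quotient_center by (simp add: iso_def bij_betw_def)
  moreover have "?h \<one>\<^bsub>?I\<^esub> = \<one>\<^bsub>?Q\<^esub>"
    using lcoset_center[OF base_point] by (simp add: HInn_def H_quotient_def)
  ultimately show ?thesis
    using group.hom_imp_img_group[OF group_HInn, of ?h ?Q] HInn_iso_quotient_center
    by (simp add: iso_def)
qed

end

theorem theorem4p18:
  fixes P :: "'a topology" and p0 :: 'a and \<mu> :: "'a \<times> 'a \<Rightarrow> 'a" and \<eta> :: "'a \<Rightarrow> 'a"
  assumes "H_group P p0 \<mu> \<eta>"
    and "homotopic_with (\<lambda>_. True) (prod_topology P P) P
      (\<eta> \<circ> \<mu>) (\<mu> \<circ> map_prod \<eta> \<eta> \<circ> (\<lambda>(x, y). (y, x)))"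
  shows "group (HInn P p0 \<mu> \<eta>) \<and> group (H_quotient P p0 \<mu> \<eta> (H_center P \<mu>)) \<and>
    HInn P p0 \<mu> \<eta> \<cong> H_quotient P p0 \<mu> \<eta> (H_center P \<mu>)"
proof -
  interpret H_group P p0 \<mu> \<eta> by fact
  show ?thesis
    using group_HInn group_quotient_center is_isoI[OF HInn_iso_quotient_center] by blast
qed

end
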